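(* Let $r\geq 1$ be an integer and let $G=(V,E)$ be a bi-critical, non-bipartite $r$-graph such that there is no odd set $X\subseteq V$ with $|X|\neq 1$, $|X|\neq |V|-1$ and $|\partial(X)|=r$. Then $G$ is a brick.
   Context: All graphs are finite and connected; multiple edges are allowed but loops are not. For $X\subseteq V$, $\partial(X)$ denotes the set of edges of $G$ with exactly one end in $X$. A set $X$ is odd if $|X|$ is odd. An $r$-graph is an $r$-regular graph $G=(V,E)$ such that $|\partial(X)|\geq r$ for every odd set $X\subseteq V$. A graph $G$ is bi-critical if $G-u-v$ has a perfect matching for every pair of distinct vertices $u,v$ of $G$. A brick is a graph that is non-bipartite, bi-critical and $3$-vertex-connected. *)

theory Defs
  imports Main
begin

record ('v, 'e) multigraph =
  verts :: "'v set"
  edges :: "'e set"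
  ends :: "'e \<Rightarrow> 'v set"

text \<open>Every edge has exactly two distinct ends, so loops are excluded; parallel edges are
  distinct elements of type \<open>'e\<close> with the same set of ends.\<close>

definition wf_multigraph :: "('v, 'e) multigraph \<Rightarrow> bool" where
  "wf_multigraph G \<longleftrightarrow>
     finite (verts G) \<and> finite (edges G) \<and>
     (\<forall>e\<in>edges G. ends G e \<subseteq> verts G \<and> card (ends G e) = 2)"

definition adjacent :: "('v, 'e) multigraph \<Rightarrow> 'v \<Rightarrow> 'v \<Rightarrow> bool" where
  "adjacent G u v \<longleftrightarrow> (\<exists>e\<in>edges G. ends G e = {u, v})"

definition connected_graph :: "('v, 'e) multigraph \<Rightarrow> bool" where
  "connected_graph G \<longleftrightarrow>
     verts G \<noteq> {} \<and> (\<forall>u\<in>verts G. \<forall>v\<in>verts G. (adjacent G)\<^sup>*\<^sup>* u v)"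

definition delete_verts :: "('v, 'e) multigraph \<Rightarrow> 'v set \<Rightarrow> ('v, 'e) multigraph" where
  "delete_verts G S =
     \<lparr>verts = verts G - S, edges = {e \<in> edges G. ends G e \<inter> S = {}}, ends = ends G\<rparr>"

definition boundary :: "('v, 'e) multigraph \<Rightarrow> 'v set \<Rightarrow> 'e set" where
  "boundary G X = {e \<in> edges G. card (ends G e \<inter> X) = 1}"

definition degree :: "('v, 'e) multigraph \<Rightarrow> 'v \<Rightarrow> nat" where
  "degree G v = card {e \<in> edges G. v \<in> ends G e}"

definition regular :: "nat \<Rightarrow> ('v, 'e) multigraph \<Rightarrow> bool" where
  "regular r G \<longleftrightarrow> (\<forall>v\<in>verts G. degree G v = r)"

definition bipartite :: "('v, 'e) multigraph \<Rightarrow> bool" where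
  "bipartite G \<longleftrightarrow>
     (\<exists>A B. A \<union> B = verts G \<and> A \<inter> B = {} \<and>
        (\<forall>e\<in>edges G. card (ends G e \<inter> A) = 1 \<and> card (ends G e \<inter> B) = 1))"

definition perfect_matching :: "('v, 'e) multigraph \<Rightarrow> 'e set \<Rightarrow> bool" where
  "perfect_matching G M \<longleftrightarrow>
     M \<subseteq> edges G \<and> (\<forall>v\<in>verts G. \<exists>!e. e \<in> M \<and> v \<in> ends G e)"

definition bicritical :: "('v, 'e) multigraph \<Rightarrow> bool" where
  "bicritical G \<longleftrightarrow>
     (\<forall>u\<in>verts G. \<forall>v\<in>verts G. u \<noteq> v \<longrightarrow>
        (\<exists>M. perfect_matching (delete_verts G {u, v}) M))"

definition vertex_connected :: "nat \<Rightarrow> ('v, 'e) multigraph \<Rightarrow> bool" where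
  "vertex_connected k G \<longleftrightarrow>
     card (verts G) > k \<and>
     (\<forall>S. S \<subseteq> verts G \<and> card S < k \<longrightarrow> connected_graph (delete_verts G S))"

definition r_graph :: "nat \<Rightarrow> ('v, 'e) multigraph \<Rightarrow> bool" where
  "r_graph r G \<longleftrightarrow>
     wf_multigraph G \<and> connected_graph G \<and> regular r G \<and>
     (\<forall>X. X \<subseteq> verts G \<and> odd (card X) \<longrightarrow> card (boundary G X) \<ge> r)"

definition brick :: "('v, 'e) multigraph \<Rightarrow> bool" where
  "brick G \<longleftrightarrow>
     wf_multigraph G \<and> connected_graph G \<and>
     \<not> bipartite G \<and> bicritical G \<and> vertex_connected 3 G"

end

theory Submission imports Defs begin

text \<open>
  A vertex cut \<open>S\<close> with at most two vertices separates \<open>V - S\<close> into nonempty parts \<open>C\<close>, \<open>D\<close>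
  without edges between them. If \<open>S = {s}\<close>, the odd part has at least \<open>r\<close> edges to \<open>s\<close>, so it uses
  all edges at \<open>s\<close> and the other part is isolated. If \<open>S = {s, t}\<close>, only \<open>2r\<close> edge ends are
  available at \<open>s\<close> and \<open>t\<close>. When \<open>C\<close> and \<open>D\<close> are odd, both are therefore tight, hence
  singletons, no edge joins \<open>s\<close> and \<open>t\<close>, and \<open>G\<close> is bipartite. When they are even,
  \<open>C \<union> {s}\<close> and \<open>C \<union> {t}\<close> are odd, nontrivial and tight, which is excluded.
\<close>

section \<open>Boundaries, connectedness and vertex cuts\<close>

lemma wf_multigraph_endsE:
  assumes "wf_multigraph G" "e \<in> edges G"
  obtains a b where "ends G e = {a, b}" "a \<noteq> b" "a \<in> verts G" "b \<in> verts G"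
  using assms unfolding wf_multigraph_def by (metis card_2_iff insert_subset)

text \<open>Turns the cardinality in \<open>boundary\<close> into a propositional condition on the
  two ends, so that later claims about edges reduce to case splits on where \<open>a\<close> and
  \<open>b\<close> lie.\<close>

lemma boundary_iff:
  assumes "e \<in> edges G" "ends G e = {a, b}" "a \<noteq> b"
  shows "e \<in> boundary G X \<longleftrightarrow> (a \<in> X) \<noteq> (b \<in> X)"
  using assms by (cases "a \<in> X"; cases "b \<in> X") (auto simp: boundary_def Int_insert_left)

lemma boundary_subset_edges: "boundary G X \<subseteq> edges G"
  by (auto simp: boundary_def)

lemma wf_multigraph_delete_verts:
  "wf_multigraph G \<Longrightarrow> wf_multigraph (delete_verts G S)"
  unfolding wf_multigraph_def delete_verts_def by auto

text \<open>If the boundary were empty, membership in \<open>X\<close> would propagate along a path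
  from a vertex inside \<open>X\<close> to one outside.\<close>

lemma connected_graph_boundary_nonempty:
  assumes wf: "wf_multigraph G" and con: "connected_graph G"
    and X: "X \<subseteq> verts G" "X \<noteq> {}" "X \<noteq> verts G"
  shows "boundary G X \<noteq> {}"
proof
  assume empty: "boundary G X = {}"
  obtain u v where u: "u \<in> X" and v: "v \<in> verts G" "v \<notin> X"
    using X by blast
  have "(adjacent G)\<^sup>*\<^sup>* u v"
    using con X u v unfolding connected_graph_def by blast
  then have "v \<in> X"
  proof (induction rule: rtranclp_induct)
    case base
    show ?case by (rule u)
  next
    case (step a b)
    then obtain e where e: "e \<in> edges G" "ends G e = {a, b}"
      unfolding adjacent_def by blast
    with wf have "card {a, b} = 2"
      unfolding wf_multigraph_def by metis
    then have "a \<noteq> b"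
      by auto
    with e step.IH empty show ?case
      using boundary_iff[OF e] by blast
  qed
  with v show False by blast
qed

lemma not_connected_graph_empty_boundary:
  assumes wf: "wf_multigraph G" and ncon: "\<not> connected_graph G" and ne: "verts G \<noteq> {}"
  obtains X where "X \<subseteq> verts G" "X \<noteq> {}" "X \<noteq> verts G" "boundary G X = {}"
proof -
  obtain u v where uv: "u \<in> verts G" "v \<in> verts G" "\<not> (adjacent G)\<^sup>*\<^sup>* u v"
    using ncon ne unfolding connected_graph_def by blast
  \<comment> \<open>The component of \<open>u\<close> is the witness: an edge leaving it would
    extend a path from \<open>u\<close> to a vertex outside it.\<close>
  define X where "X = {w \<in> verts G. (adjacent G)\<^sup>*\<^sup>* u w}"
  have closed: "b \<in> X" if "a \<in> X" "adjacent G a b" "b \<in> verts G" for a b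
    using that unfolding X_def by (auto intro: rtranclp.rtrancl_into_rtrancl)
  have "boundary G X = {}"
  proof (rule ccontr)
    assume "boundary G X \<noteq> {}"
    then obtain e where e: "e \<in> boundary G X" "e \<in> edges G"
      using boundary_subset_edges[of G X] by blast
    from wf e(2) obtain a b where ab: "ends G e = {a, b}" "a \<noteq> b" "a \<in> verts G" "b \<in> verts G"
      by (rule wf_multigraph_endsE)
    have "adjacent G a b" "adjacent G b a"
      using e ab unfolding adjacent_def by (auto simp: insert_commute)
    with closed ab e show False
      using boundary_iff[OF e(2) ab(1,2)] by blast
  qed
  moreover have "u \<in> X" "v \<notin> X" "X \<subseteq> verts G"
    using uv by (auto simp: X_def)
  ultimately show ?thesis
    using that uv by blast
qed

text \<open>Moves a disconnection of \<open>delete_verts G S\<close> back to \<open>G\<close>: an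
  edge between \<open>C\<close> and \<open>D\<close> avoids \<open>S\<close>, so it survives the
  deletion and would lie in the empty boundary of \<open>C\<close>. All later counting then stays in
  \<open>G\<close>.\<close>

lemma vertex_cutE:
  assumes wf: "wf_multigraph G" and ncon: "\<not> connected_graph (delete_verts G S)"
    and ne: "verts G - S \<noteq> {}"
  obtains C D where "C \<noteq> {}" "D \<noteq> {}" "C \<union> D = verts G - S" "C \<inter> D = {}"
    "\<And>e. e \<in> edges G \<Longrightarrow> ends G e \<inter> C = {} \<or> ends G e \<inter> D = {}"
proof -
  let ?H = "delete_verts G S"
  have H: "verts ?H = verts G - S"
    by (simp add: delete_verts_def)
  from wf_multigraph_delete_verts[OF wf] ncon ne[folded H]
  obtain C where C: "C \<subseteq> verts ?H" "C \<noteq> {}" "C \<noteq> verts ?H" "boundary ?H C = {}"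
    by (rule not_connected_graph_empty_boundary)
  define D where "D = verts G - S - C"
  have "ends G e \<inter> C = {} \<or> ends G e \<inter> D = {}" if e: "e \<in> edges G" for e
  proof (rule ccontr)
    assume *: "\<not> ?thesis"
    from wf e obtain a b where ab: "ends G e = {a, b}" "a \<noteq> b" "a \<in> verts G" "b \<in> verts G"
      by (rule wf_multigraph_endsE)
    have "ends G e \<inter> S = {}"
      using * ab C(1) unfolding D_def H by auto
    then have "e \<in> edges ?H" "ends ?H e = {a, b}"
      using e ab by (auto simp: delete_verts_def)
    from boundary_iff[OF this ab(2), of C] C(4) * ab show False
      by (auto simp: D_def)
  qed
  with that[of C D] C show ?thesis
    unfolding D_def H by blast
qed

section \<open>Parity and edge counting\<close>

lemma boundary_verts:
  assumes "wf_multigraph G"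
  shows "boundary G (verts G) = {}"
  using assms unfolding boundary_def wf_multigraph_def by (auto simp: Int_absorb2)

text \<open>Were the order odd, the cut condition for the whole vertex set would demand at least
  \<open>r\<close>, hence at least one, edge in an empty boundary.\<close>

lemma r_graph_even_card:
  assumes "r_graph r G" "r \<ge> 1"
  shows "even (card (verts G))"
  using assms boundary_verts[of G] unfolding r_graph_def
  by (metis card.empty not_one_le_zero le_zero_eq subset_refl)

text \<open>Without loops, every edge must join the only two vertices. This later rules out order
  2.\<close>

lemma card_two_bipartite:
  assumes wf: "wf_multigraph G" and "card (verts G) = 2"
  shows "bipartite G"
proof -
  obtain u v where uv: "verts G = {u, v}" "u \<noteq> v"
    using assms(2) by (meson card_2_iff)
  have "ends G e = {u, v}" if "e \<in> edges G" for e
    using wf that uv unfolding wf_multigraph_def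
    by (metis card_2_iff' card_subset_eq finite.emptyI finite.insertI assms(2))
  then show ?thesis
    unfolding bipartite_def using uv
    by (intro exI[of _ "{u}"] exI[of _ "{v}"]) (auto simp: Int_insert_left)
qed

text \<open>Each sum is the size of the union plus that of the intersection. Both terms for
  \<open>A\<close>, \<open>B\<close> are bounded by those for \<open>P\<close>, \<open>Q\<close>, so
  \<open>le\<close> forces equality in both. Below, \<open>P\<close> and \<open>Q\<close> are the
  edge sets at \<open>s\<close> and \<open>t\<close>; an edge joining \<open>s\<close> and
  \<open>t\<close> counts twice.\<close>

lemma card_pair_tight:
  assumes fin: "finite P" "finite Q"
    and sub: "A \<union> B \<subseteq> P \<union> Q" "A \<inter> B \<subseteq> P \<inter> Q"
    and le: "card P + card Q \<le> card A + card B"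
  shows "card A + card B = card P + card Q" "A \<inter> B = P \<inter> Q"
proof -
  have "finite A" "finite B"
    using fin sub by (meson finite_Un finite_subset)+
  then have AB: "card A + card B = card (A \<union> B) + card (A \<inter> B)"
    by (rule card_Un_Int)
  have PQ: "card P + card Q = card (P \<union> Q) + card (P \<inter> Q)"
    using fin by (rule card_Un_Int)
  have 1: "card (A \<union> B) \<le> card (P \<union> Q)" "card (A \<inter> B) \<le> card (P \<inter> Q)"
    using fin sub by (auto intro: card_mono)
  then show "card A + card B = card P + card Q"
    using AB PQ le by linarith
  have "card (A \<inter> B) = card (P \<inter> Q)"
    using 1 AB PQ le by linarith
  then show "A \<inter> B = P \<inter> Q"
    using fin sub by (simp add: card_subset_eq)
qed

definition incident_edges :: "('v, 'e) multigraph \<Rightarrow> 'v \<Rightarrow> 'e set" where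
  "incident_edges G v = {e \<in> edges G. v \<in> ends G e}"

lemma finite_incident_edges: "wf_multigraph G \<Longrightarrow> finite (incident_edges G v)"
  by (simp add: incident_edges_def wf_multigraph_def)

lemma r_graph_card_incident_edges:
  "r_graph r G \<Longrightarrow> v \<in> verts G \<Longrightarrow> card (incident_edges G v) = r"
  by (simp add: incident_edges_def r_graph_def regular_def degree_def)

section \<open>Excluding cuts of one or two vertices\<close>

lemma r_graph_no_cut_vertex:
  assumes G: "r_graph r G" and r: "r \<ge> 1" and s: "s \<in> verts G"
    and ne: "verts G - {s} \<noteq> {}"
  shows "connected_graph (delete_verts G {s})"
proof (rule ccontr)
  assume ncon: "\<not> ?thesis"
  from G have wf: "wf_multigraph G" and con: "connected_graph G"
    by (auto simp: r_graph_def)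
  then have fin: "finite (verts G)"
    by (simp add: wf_multigraph_def)
  \<comment> \<open>Stated for odd \<open>C\<close> only; the roles of \<open>C\<close> and
    \<open>D\<close> are exchanged at the end if \<open>D\<close> is the odd part.\<close>
  have *: False if CD: "D \<noteq> {}" "C \<union> D = verts G - {s}" "C \<inter> D = {}" "odd (card C)"
    and sep: "\<And>e. e \<in> edges G \<Longrightarrow> ends G e \<inter> C = {} \<or> ends G e \<inter> D = {}" for C D
  proof -
    have bd: "boundary G C \<subseteq> incident_edges G s" "boundary G D \<subseteq> incident_edges G s"
      "boundary G C \<inter> boundary G D = {}"
    proof -
      have "(e \<in> boundary G C \<longrightarrow> s \<in> ends G e \<and> e \<notin> boundary G D) \<and>
            (e \<in> boundary G D \<longrightarrow> s \<in> ends G e)" if e: "e \<in> edges G" for e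
      proof -
        from wf e obtain a b where ab: "ends G e = {a, b}" "a \<noteq> b" "a \<in> verts G" "b \<in> verts G"
          by (rule wf_multigraph_endsE)
        then show ?thesis
          using boundary_iff[OF e ab(1,2)] sep[OF e] CD(2,3) by auto
      qed
      then show "boundary G C \<subseteq> incident_edges G s" "boundary G D \<subseteq> incident_edges G s"
        "boundary G C \<inter> boundary G D = {}"
        using boundary_subset_edges[of G] unfolding incident_edges_def by blast+
    qed
    have "C \<subseteq> verts G"
      using CD by blast
    then have "card (incident_edges G s) \<le> card (boundary G C)"
      using G CD r_graph_card_incident_edges[OF G s] by (auto simp: r_graph_def)
    then have "boundary G C = incident_edges G s"
      using bd(1) finite_incident_edges[OF wf] by (meson card_seteq)
    then have "boundary G D = {}"
      using bd by blast
    moreover have "boundary G D \<noteq> {}"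
      using CD s by (intro connected_graph_boundary_nonempty[OF wf con]) blast+
    ultimately show False by blast
  qed
  from wf ncon ne obtain C D where CD: "C \<noteq> {}" "D \<noteq> {}" "C \<union> D = verts G - {s}" "C \<inter> D = {}"
    and sep: "\<And>e. e \<in> edges G \<Longrightarrow> ends G e \<inter> C = {} \<or> ends G e \<inter> D = {}"
    by (rule vertex_cutE) blast
  have finCD: "finite C" "finite D"
    using fin CD(3) by (metis finite_Diff finite_Un)+
  have "odd (card (verts G - {s}))"
    using r_graph_even_card[OF G r] fin s
    by (metis card_Suc_Diff1 even_Suc)
  then have "odd (card C + card D)"
    using CD finCD by (simp flip: card_Un_disjoint)
  then consider "odd (card C)" | "odd (card D)"
    by auto
  then show False
  proof cases
    case 1
    then show False using *[OF CD(2-4) _ sep] by blast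
  next
    case 2
    have "D \<union> C = verts G - {s}" "D \<inter> C = {}"
      using CD by blast+
    with 2 show False using *[of C D] CD(1) sep by blast
  qed
qed

lemma r_graph_no_cut_pair:
  assumes G: "r_graph r G" and r: "r \<ge> 1"
    and st: "s \<in> verts G" "t \<in> verts G" "s \<noteq> t" and ne: "verts G - {s, t} \<noteq> {}"
    and nbip: "\<not> bipartite G"
    and tight: "\<And>X. X \<subseteq> verts G \<Longrightarrow> odd (card X) \<Longrightarrow> card (boundary G X) = r \<Longrightarrow>
                  card X = 1 \<or> card X = card (verts G) - 1"
  shows "connected_graph (delete_verts G {s, t})"
proof (rule ccontr)
  assume ncon: "\<not> ?thesis"
  from G have wf: "wf_multigraph G"
    and cut: "\<And>X. X \<subseteq> verts G \<Longrightarrow> odd (card X) \<Longrightarrow> r \<le> card (boundary G X)"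
    by (auto simp: r_graph_def)
  then have fin: "finite (verts G)"
    by (simp add: wf_multigraph_def)
  let ?I = "incident_edges G"
  note finI = finite_incident_edges[OF wf]
  have cardI: "card (?I s) = r" "card (?I t) = r"
    using r_graph_card_incident_edges[OF G] st by auto
  from wf ncon ne obtain C D where CD: "C \<noteq> {}" "D \<noteq> {}" "C \<union> D = verts G - {s, t}" "C \<inter> D = {}"
    and sep: "\<And>e. e \<in> edges G \<Longrightarrow> ends G e \<inter> C = {} \<or> ends G e \<inter> D = {}"
    by (rule vertex_cutE) blast
  have finCD: "finite C" "finite D"
    using fin CD(3) by (metis finite_Diff finite_Un)+
  have V: "verts G = insert s (insert t (C \<union> D))"
    using CD(3) st by blast
  have notin: "s \<notin> C" "s \<notin> D" "t \<notin> C" "t \<notin> D"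
    using CD(3) by blast+
  have cardV: "card (verts G) = card C + card D + 2"
    unfolding V using finCD notin st(3) CD(4) by (simp add: card_Un_disjoint)
  have pos: "card C > 0" "card D > 0"
    using CD finCD by (auto simp: card_gt_0_iff)
  show False
  proof (cases "odd (card C)")
    case True
    then have oddD: "odd (card D)"
      using r_graph_even_card[OF G r] cardV by simp
    have e: "(e \<in> boundary G C \<longrightarrow> (s \<in> ends G e \<or> t \<in> ends G e) \<and> e \<notin> boundary G D) \<and>
          (e \<in> boundary G D \<longrightarrow> s \<in> ends G e \<or> t \<in> ends G e)" if e: "e \<in> edges G" for e
    proof -
      from wf e obtain a b where ab: "ends G e = {a, b}" "a \<noteq> b" "a \<in> verts G" "b \<in> verts G"
        by (rule wf_multigraph_endsE)
      then show ?thesis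
        using boundary_iff[OF e ab(1,2)] sep[OF e] CD(4) notin unfolding V by auto
    qed
    have sub: "boundary G C \<union> boundary G D \<subseteq> ?I s \<union> ?I t"
      and disj: "boundary G C \<inter> boundary G D = {}"
      using e boundary_subset_edges[of G] unfolding incident_edges_def by blast+
    have ge: "r \<le> card (boundary G C)" "r \<le> card (boundary G D)"
      using cut[of C] cut[of D] True oddD unfolding V by blast+
    \<comment> \<open>Each boundary has at least \<open>r\<close> edges and the two degrees sum to
      \<open>2 * r\<close>. Tightness also makes the right-hand intersection empty: no edge joins
      \<open>s\<close> and \<open>t\<close>.\<close>
    have "card (boundary G C) + card (boundary G D) = card (?I s) + card (?I t)"
      and "boundary G C \<inter> boundary G D = ?I s \<inter> ?I t"
      using ge cardI disj by (intro card_pair_tight[OF finI finI sub]; simp)+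
    then have eq: "card (boundary G C) = r" "card (boundary G D) = r" and no_st: "?I s \<inter> ?I t = {}"
      using ge cardI disj by auto
    \<comment> \<open>The alternative \<open>card (verts G) - 1\<close> equals
      \<open>card C + card D + 1\<close>, too large for either part.\<close>
    have "card C = 1" "card D = 1"
      using tight[of C] tight[of D] True oddD eq cardV pos unfolding V by auto
    then obtain c d where cd: "C = {c}" "D = {d}"
      by (meson card_1_singletonE)
    \<comment> \<open>The colour classes are \<open>{c, d}\<close> and \<open>{s, t}\<close>:
      \<open>sep\<close> forbids edges between \<open>c\<close> and \<open>d\<close>,
      \<open>no_st\<close> those between \<open>s\<close> and \<open>t\<close>.\<close>
    have "card (ends G e \<inter> {c, d}) = 1 \<and> card (ends G e \<inter> {s, t}) = 1" if e: "e \<in> edges G" for e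
    proof -
      from wf e obtain a b where ab: "ends G e = {a, b}" "a \<noteq> b" "a \<in> verts G" "b \<in> verts G"
        by (rule wf_multigraph_endsE)
      have "\<not> (s \<in> ends G e \<and> t \<in> ends G e)"
        using no_st e unfolding incident_edges_def by blast
      then have "(a \<in> {c, d}) \<noteq> (b \<in> {c, d})" "(a \<in> {s, t}) \<noteq> (b \<in> {s, t})"
        using ab sep[OF e] notin CD(4) unfolding V cd by auto
      then show ?thesis
        using boundary_iff[OF e ab(1,2)] unfolding boundary_def by blast
    qed
    then have "bipartite G"
      unfolding bipartite_def using V notin CD(4) unfolding cd
      by (intro exI[of _ "{c, d}"] exI[of _ "{s, t}"]) auto
    with nbip show False ..
  next
    case False
    \<comment> \<open>Adding one cut vertex to the even \<open>C\<close> gives an odd set. An edge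
      from \<open>s\<close> to \<open>C\<close> leaves only \<open>?B\<close>, one from
      \<open>s\<close> to \<open>D\<close> only \<open>?A\<close>, symmetrically for
      \<open>t\<close>, and an edge joining \<open>s\<close> and \<open>t\<close> leaves both: the
      boundaries count edges just as the two degrees do.\<close>
    let ?A = "insert s C" and ?B = "insert t C"
    have card: "card ?A = card C + 1" "card ?B = card C + 1"
      using finCD notin by auto
    have e: "(e \<in> boundary G ?A \<or> e \<in> boundary G ?B \<longrightarrow> s \<in> ends G e \<or> t \<in> ends G e) \<and>
          (e \<in> boundary G ?A \<and> e \<in> boundary G ?B \<longrightarrow> s \<in> ends G e \<and> t \<in> ends G e)"
      if e: "e \<in> edges G" for e
    proof -
      from wf e obtain a b where ab: "ends G e = {a, b}" "a \<noteq> b" "a \<in> verts G" "b \<in> verts G"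
        by (rule wf_multigraph_endsE)
      then show ?thesis
        using boundary_iff[OF e ab(1,2)] sep[OF e] CD(4) notin st(3) unfolding V by auto
    qed
    have sub: "boundary G ?A \<union> boundary G ?B \<subseteq> ?I s \<union> ?I t"
      "boundary G ?A \<inter> boundary G ?B \<subseteq> ?I s \<inter> ?I t"
      using e boundary_subset_edges[of G] unfolding incident_edges_def by blast+
    have AB: "?A \<subseteq> verts G" "?B \<subseteq> verts G" "odd (card ?A)" "odd (card ?B)"
      unfolding card using False unfolding V by auto
    have ge: "r \<le> card (boundary G ?A)" "r \<le> card (boundary G ?B)"
      using cut AB by blast+
    then have "card (boundary G ?A) + card (boundary G ?B) = r + r"
      using card_pair_tight(1)[OF finI finI sub] cardI by simp
    then have "card (boundary G ?A) = r"
      using ge by simp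
    \<comment> \<open>The size \<open>card C + 1\<close> exceeds 1 since \<open>C\<close> is
      nonempty, and is below \<open>card (verts G) - 1\<close> since \<open>D\<close> is
      nonempty.\<close>
    from tight[OF AB(1,3) this] show False
      using card cardV pos by auto
  qed
qed

section \<open>Three-connectedness of the whole graph\<close>

theorem theorem3:
  fixes G :: "('v, 'e) multigraph" and r :: nat
  assumes "r \<ge> 1"
    and "r_graph r G"
    and "bicritical G"
    and "\<not> bipartite G"
    and "\<not> (\<exists>X. X \<subseteq> verts G \<and> odd (card X) \<and> card X \<noteq> 1 \<and>
               card X \<noteq> card (verts G) - 1 \<and> card (boundary G X) = r)"
  shows "brick G"
proof -
  from assms(2) have wf: "wf_multigraph G" and con: "connected_graph G"
    by (auto simp: r_graph_def)
  then have fin: "finite (verts G)" and "card (verts G) \<noteq> 0"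
    by (auto simp: wf_multigraph_def connected_graph_def)
  moreover have "card (verts G) \<noteq> 2"
    using card_two_bipartite wf assms(4) by blast
  moreover have "even (card (verts G))"
    using r_graph_even_card assms(1,2) by blast
  \<comment> \<open>An even order other than 0 and 2 is at least 4, as
    \<open>vertex_connected 3 G\<close> demands.\<close>
  ultimately have card: "card (verts G) > 3"
    by presburger
  have "connected_graph (delete_verts G S)" if S: "S \<subseteq> verts G" "card S < 3" for S
  proof -
    have "finite S"
      using S fin by (meson finite_subset)
    have ne: "verts G - S \<noteq> {}"
      using S card fin by (metis Diff_eq_empty_iff card_mono \<open>finite S\<close> leD less_trans le_less_trans)
    consider "card S = 0" | "card S = 1" | "card S = 2"
      using S by linarith
    then show ?thesis
    proof cases
      case 1
      then have "S = {}"
        using \<open>finite S\<close> by simp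
      moreover have "adjacent (delete_verts G {}) = adjacent G"
        by (intro ext) (simp add: adjacent_def delete_verts_def)
      ultimately show ?thesis
        using con by (simp add: connected_graph_def) (simp add: delete_verts_def)
    next
      case 2
      then obtain s where "S = {s}"
        by (meson card_1_singletonE)
      then show ?thesis
        using r_graph_no_cut_vertex[OF assms(2,1)] S ne by simp
    next
      case 3
      then obtain s t where st: "S = {s, t}" "s \<noteq> t"
        by (meson card_2_iff)
      show ?thesis
        unfolding st(1)
        by (rule r_graph_no_cut_pair[OF assms(2,1) _ _ st(2) _ assms(4)])
          (use S ne st assms(5) in blast)+
    qed
  qed
  with card have "vertex_connected 3 G"
    by (auto simp: vertex_connected_def)
  with wf con assms(3,4) show ?thesis
    by (simp add: brick_def)
qed

end
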